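(* Assume that $T$ can represent any function of two variables and that $q_\phi(z\mid x)$ can represent any probability density on the latent space. Suppose $(\theta^*,\phi^*,T^* )$ defines a Nash equilibrium of the following two-player game. The first player chooses $T$ so as to maximize $$\mathbb{E}_{p_{\mathcal D}(x)}\mathbb{E}_{q_\phi(z\mid x)}\log\sigma(T(x,z))+\mathbb{E}_{p_{\mathcal D}(x)}\mathbb{E}_{p(z)}\log\bigl(1-\sigma(T(x,z))\bigr),\qquad \sigma(t)=(1+e^{-t})^{-1},$$ and the second player chooses $(\theta,\phi)$ so as to maximize $$\mathbb{E}_{p_{\mathcal D}(x)}\mathbb{E}_{\epsilon}\bigl(-T(x,z_\phi(x,\epsilon))+\log p_\theta(x\mid z_\phi(x,\epsilon))\bigr).$$ Then: 1. $\theta^*$ is a maximum-likelihood assignment, i.e. $\theta^*$ maximizes $\mathbb{E}_{p_{\mathcal D}(x)}\log p_\theta(x)$ over $\theta$; 2. $q_{\phi^*}(z\mid x)$ is equal to the true posterior $p_{\theta^*}(z\mid x)$; 3. $T^*$ is the pointwise mutual information between $x$ and $z$, i.e. $$T^*(x,z)=\log\frac{p_{\theta^*}(x,z)}{p_{\theta^*}(x)\,p(z)}.$$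
   Context: Here $p_{\mathcal D}(x)$ is the data distribution (a probability density on the data space), $p(z)$ is the prior (a probability density on the latent space), $p_\theta(x\mid z)$ is the generative model with parameter $\theta$ (a conditional density of $x$ given $z$), and $q_\phi(z\mid x)$ is the inference model with parameter $\phi$ (a conditional density of $z$ given $x$). The discriminator $T(x,z)$ is a real-valued function of $x$ and $z$. Write $p_\theta(x,z)=p_\theta(x\mid z)p(z)$ for the joint density, $p_\theta(x)=\int p_\theta(x,z)\,dz$ for the marginal likelihood and $p_\theta(z\mid x)=p_\theta(x,z)/p_\theta(x)$ for the posterior. The function $z_\phi(x,\epsilon)$ reparameterizes the inference model: when the noise variable $\epsilon$ is drawn from its fixed distribution, $z_\phi(x,\epsilon)$ is distributed according to $q_\phi(z\mid x)$, so the second player's objective equals $\mathbb{E}_{p_{\mathcal D}(x)}\mathbb{E}_{q_\phi(z\mid x)}(-T(x,z)+\log p_\theta(x\mid z))$. Nash equilibrium means: $T^*$ maximizes the first objective over $T$ when $\phi=\phi^*$, and $(\theta^*,\phi^* )$ maximizes the second objective over $(\theta,\phi)$ when $T=T^*$ is held fixed.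
   Formalization: The second player's objective is additionally assumed to be finite at the equilibrium; without this (e.g. when the generative density vanishes on part of the data) the inference model is unconstrained and claim 2 can fail. *)

theory Defs
  imports "HOL-Probability.Probability"
begin

definition prob_density :: "'a measure \<Rightarrow> ('a \<Rightarrow> real) \<Rightarrow> bool" where
  "prob_density M f \<longleftrightarrow>
     f \<in> borel_measurable M \<and> (\<forall>x\<in>space M. 0 \<le> f x) \<and> (\<integral>\<^sup>+x. ennreal (f x) \<partial>M) = 1"

text \<open>\<open>k x y\<close> is the density at \<open>y\<close>, conditional on \<open>x\<close>.\<close>

definition cond_density :: "'a measure \<Rightarrow> 'b measure \<Rightarrow> ('a \<Rightarrow> 'b \<Rightarrow> real) \<Rightarrow> bool" where
  "cond_density A B k \<longleftrightarrow>
     (\<lambda>(x, y). k x y) \<in> borel_measurable (A \<Otimes>\<^sub>M B) \<and> (\<forall>x\<in>space A. prob_density B (k x))"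

definition law :: "'a measure \<Rightarrow> ('a \<Rightarrow> real) \<Rightarrow> 'a measure" where
  "law M f = density M (\<lambda>x. ennreal (f x))"

definition sigma :: "real \<Rightarrow> real" where
  "sigma t = inverse (1 + exp (- t))"

text \<open>The library has \<open>ln 0 = 0\<close>; here \<open>log 0 = -\<infinity>\<close>. The function is only
  used at nonnegative arguments.\<close>

definition elog :: "real \<Rightarrow> ereal" where
  "elog t = (if 0 < t then ereal (ln t) else - \<infinity>)"

text \<open>The Bochner integral of a non-integrable function is \<open>0\<close>, which would make a
  divergent payoff look good to a maximizer. The expectation below takes values in the
  extended reals. If positive and negative part both have infinite
  integral, it does not exist, and the value is set to \<open>-\<infinity>\<close>, so that a choice without a
  well-defined expectation never beats another one.\<close>

definition expect :: "'a measure \<Rightarrow> ('a \<Rightarrow> ereal) \<Rightarrow> ereal" where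
  "expect M f =
     (let p = \<integral>\<^sup>+x. e2ennreal (f x) \<partial>M; n = \<integral>\<^sup>+x. e2ennreal (- f x) \<partial>M
      in if p = \<infinity> \<and> n = \<infinity> then - \<infinity> else enn2ereal p - enn2ereal n)"

definition joint :: "('z \<Rightarrow> real) \<Rightarrow> ('x \<Rightarrow> 'z \<Rightarrow> real) \<Rightarrow> 'x \<Rightarrow> 'z \<Rightarrow> real" where
  "joint prior g x z = g x z * prior z"

definition marginal :: "'z measure \<Rightarrow> ('z \<Rightarrow> real) \<Rightarrow> ('x \<Rightarrow> 'z \<Rightarrow> real) \<Rightarrow> 'x \<Rightarrow> real" where
  "marginal MZ prior g x = (\<integral>z. joint prior g x z \<partial>MZ)"

definition posterior ::
  "'z measure \<Rightarrow> ('z \<Rightarrow> real) \<Rightarrow> ('x \<Rightarrow> 'z \<Rightarrow> real) \<Rightarrow> 'x \<Rightarrow> 'z \<Rightarrow> real" where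
  "posterior MZ prior g x z = joint prior g x z / marginal MZ prior g x"

text \<open>\<open>D\<close> is the data distribution, \<open>P\<close> the prior distribution, \<open>Q x\<close> the inference
  distribution given \<open>x\<close>, \<open>N\<close> the noise distribution, \<open>\<zeta>\<close> the reparameterization and
  \<open>g x z\<close> the generative density of \<open>x\<close> given \<open>z\<close>.\<close>

definition payoff1 ::
  "'x measure \<Rightarrow> 'z measure \<Rightarrow> ('x \<Rightarrow> 'z measure) \<Rightarrow> ('x \<Rightarrow> 'z \<Rightarrow> real) \<Rightarrow> ereal" where
  "payoff1 D P Q T =
     expect D (\<lambda>x. expect (Q x) (\<lambda>z. ereal (ln (sigma (T x z))))) +
     expect D (\<lambda>x. expect P (\<lambda>z. ereal (ln (1 - sigma (T x z)))))"

definition payoff2 ::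
  "'x measure \<Rightarrow> 'e measure \<Rightarrow> ('x \<Rightarrow> 'z \<Rightarrow> real) \<Rightarrow> ('x \<Rightarrow> 'e \<Rightarrow> 'z) \<Rightarrow>
     ('x \<Rightarrow> 'z \<Rightarrow> real) \<Rightarrow> ereal" where
  "payoff2 D N g \<zeta> T =
     expect D (\<lambda>x. expect N (\<lambda>\<epsilon>. ereal (- T x (\<zeta> x \<epsilon>)) + elog (g x (\<zeta> x \<epsilon>))))"

definition nash_equilibrium ::
  "'x measure \<Rightarrow> 'z measure \<Rightarrow> 'e measure \<Rightarrow> ('x \<Rightarrow> real) \<Rightarrow> ('z \<Rightarrow> real) \<Rightarrow>
     't set \<Rightarrow> ('t \<Rightarrow> 'x \<Rightarrow> 'z \<Rightarrow> real) \<Rightarrow>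
     'f set \<Rightarrow> ('f \<Rightarrow> 'x \<Rightarrow> 'z \<Rightarrow> real) \<Rightarrow> ('f \<Rightarrow> 'x \<Rightarrow> 'e \<Rightarrow> 'z) \<Rightarrow>
     't \<Rightarrow> 'f \<Rightarrow> ('x \<Rightarrow> 'z \<Rightarrow> real) \<Rightarrow> bool" where
  "nash_equilibrium MX MZ N pD prior \<Theta> p \<Phi> q \<zeta> \<theta>s \<phi>s Ts \<longleftrightarrow>
     is_arg_max (payoff1 (law MX pD) (law MZ prior) (\<lambda>x. law MZ (q \<phi>s x)))
       (\<lambda>T. (\<lambda>(x, z). T x z) \<in> borel_measurable (MX \<Otimes>\<^sub>M MZ)) Ts \<and>
     is_arg_max (\<lambda>(\<theta>, \<phi>). payoff2 (law MX pD) N (p \<theta>) (\<zeta> \<phi>) Ts)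
       (\<lambda>(\<theta>, \<phi>). \<theta> \<in> \<Theta> \<and> \<phi> \<in> \<Phi>) (\<theta>s, \<phi>s)"

end

theory Submission
  imports Defs
begin

text \<open>
  The first player's payoff is minus the integral of the pointwise loss
  \<open>q log (1 + exp (- T)) + p(z) log (1 + exp T)\<close>, which has the unique minimizer \<open>log (q / p(z))\<close> if
  both weights are positive and no minimizer if exactly one of them is. So at equilibrium \<open>q\<close> and
  the prior vanish at the same points and \<open>T\<^sup>* = log (q / p(z))\<close> elsewhere.

  The second player's payoff is linear in \<open>q\<close>: restricting \<open>q(\<cdot> | x)\<close> to the set where the integrand
  exceeds its conditional mean \<open>h(x)\<close> would raise the payoff, so the integrand equals \<open>h(x)\<close> almost
  everywhere. With the above form of \<open>T\<^sup>*\<close> this says \<open>p(x, z) = exp (h(x)) q(z | x)\<close>, whence \<open>q\<close> is the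
  posterior, \<open>h\<close> is the log evidence, and the payoff is the expected log-likelihood.

  If the second player deviates to another \<open>\<theta>\<close> together with its posterior, the payoff is the
  expected log-likelihood of \<open>\<theta>\<close> plus an expected Kullback-Leibler divergence, so \<open>\<theta>\<close> cannot
  have a larger likelihood.
\<close>

subsection \<open>Extended-real expectations\<close>

text \<open>Monotonicity survives the convention for undefined expectations: if the negative part of
  \<open>g\<close> has infinite integral, so does that of \<open>f\<close>, and then
  \<open>expect M f\<close> is \<open>-\<infinity>\<close> in either branch of the
  definition.\<close>

lemma expect_mono_AE:
  assumes "AE x in M. f x \<le> g x"
  shows "expect M f \<le> expect M g"
proof -
  have p: "(\<integral>\<^sup>+x. e2ennreal (f x) \<partial>M) \<le> (\<integral>\<^sup>+x. e2ennreal (g x) \<partial>M)"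
    by (rule nn_integral_mono_AE) (use assms in eventually_elim, simp add: e2ennreal_mono)
  have n: "(\<integral>\<^sup>+x. e2ennreal (- g x) \<partial>M) \<le> (\<integral>\<^sup>+x. e2ennreal (- f x) \<partial>M)"
    by (rule nn_integral_mono_AE) (use assms in eventually_elim, simp add: e2ennreal_mono)
  have "enn2ereal (\<integral>\<^sup>+x. e2ennreal (f x) \<partial>M) - enn2ereal (\<integral>\<^sup>+x. e2ennreal (- f x) \<partial>M)
     \<le> enn2ereal (\<integral>\<^sup>+x. e2ennreal (g x) \<partial>M) - enn2ereal (\<integral>\<^sup>+x. e2ennreal (- g x) \<partial>M)"
    using p n by (intro ereal_minus_mono) (simp_all add: less_eq_ennreal.rep_eq)
  then show ?thesis
    using p n
    by (cases "\<integral>\<^sup>+x. e2ennreal (f x) \<partial>M") (auto simp: expect_def Let_def top_unique)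
qed

lemma expect_cong_AE:
  assumes "AE x in M. f x = g x"
  shows "expect M f = expect M g"
  by (intro antisym expect_mono_AE) (use assms in eventually_elim, simp)+

lemma expect_cong:
  assumes "\<And>x. x \<in> space M \<Longrightarrow> f x = g x"
  shows "expect M f = expect M g"
  by (intro expect_cong_AE AE_I2 assms)

lemma expect_integrable:
  assumes "integrable M f"
  shows "expect M (\<lambda>x. ereal (f x)) = ereal (integral\<^sup>L M f)"
proof -
  obtain r q where rq: "0 \<le> r" "0 \<le> q"
    "(\<integral>\<^sup>+x. ennreal (f x) \<partial>M) = ennreal r" "(\<integral>\<^sup>+x. ennreal (- f x) \<partial>M) = ennreal q"
    "integral\<^sup>L M f = r - q"
    using assms by (rule integrableE)
  then show ?thesis
    by (simp add: expect_def Let_def)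
qed

text \<open>The way back to the Bochner integral: a finite value can only arise when positive and
  negative part both have finite integrals, so \<open>f\<close> is almost everywhere real and
  integrable.\<close>

lemma expect_finiteD:
  assumes f: "f \<in> borel_measurable M" and fin: "\<bar>expect M f\<bar> \<noteq> \<infinity>"
  obtains g where "integrable M g" "AE x in M. f x = ereal (g x)" "expect M f = ereal (integral\<^sup>L M g)"
proof -
  have pn: "(\<integral>\<^sup>+x. e2ennreal (f x) \<partial>M) \<noteq> \<infinity>" "(\<integral>\<^sup>+x. e2ennreal (- f x) \<partial>M) \<noteq> \<infinity>"
    using fin
    by (cases "\<integral>\<^sup>+x. e2ennreal (f x) \<partial>M"; auto simp: expect_def Let_def split: if_splits)+
  define g where "g x = real_of_ereal (f x)" for x
  have [measurable]: "g \<in> borel_measurable M"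
    unfolding g_def using f by measurable
  have "AE x in M. e2ennreal (f x) \<noteq> \<infinity>" "AE x in M. e2ennreal (- f x) \<noteq> \<infinity>"
    by (rule nn_integral_PInf_AE; use f pn in measurable)+
  then have eq: "AE x in M. f x = ereal (g x)"
  proof eventually_elim
    case (elim x)
    then show ?case by (cases "f x") (auto simp: g_def)
  qed
  have "(\<integral>\<^sup>+x. ennreal (g x) \<partial>M) = (\<integral>\<^sup>+x. e2ennreal (f x) \<partial>M)"
    by (rule nn_integral_cong_AE) (use eq in eventually_elim, simp)
  moreover have "(\<integral>\<^sup>+x. ennreal (- g x) \<partial>M) = (\<integral>\<^sup>+x. e2ennreal (- f x) \<partial>M)"
    by (rule nn_integral_cong_AE) (use eq in eventually_elim, simp)
  ultimately have int: "integrable M g"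
    using pn by (auto simp: real_integrable_def)
  have "expect M f = expect M (\<lambda>x. ereal (g x))"
    by (rule expect_cong_AE[OF eq])
  with int eq show thesis
    by (intro that) (simp_all add: expect_integrable)
qed

lemma expect_distr:
  assumes "h \<in> measurable N M" "f \<in> borel_measurable M"
  shows "expect (distr N M h) f = expect N (\<lambda>x. f (h x))"
  using assms by (simp add: expect_def nn_integral_distr)

lemma expect_nonpos:
  assumes "\<And>x. f x \<le> 0"
  shows "expect M f = - enn2ereal (\<integral>\<^sup>+x. e2ennreal (- f x) \<partial>M)"
  using assms by (simp add: expect_def e2ennreal_neg zero_ennreal.rep_eq)

text \<open>Equality case of monotonicity. Finiteness permits subtraction, and the nonnegative
  difference \<open>v - u\<close> integrates to 0. Serves to turn optimality of an integral into
  pointwise optimality.\<close>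

lemma nn_integral_eq_imp_AE_eq:
  fixes u v :: "'a \<Rightarrow> ennreal"
  assumes [measurable]: "u \<in> borel_measurable M" "v \<in> borel_measurable M"
    and le: "AE x in M. u x \<le> v x"
    and int: "(\<integral>\<^sup>+x. v x \<partial>M) \<le> (\<integral>\<^sup>+x. u x \<partial>M)" and fin: "(\<integral>\<^sup>+x. v x \<partial>M) \<noteq> \<infinity>"
  shows "AE x in M. u x = v x"
proof -
  have eq: "(\<integral>\<^sup>+x. v x \<partial>M) = (\<integral>\<^sup>+x. u x \<partial>M)"
    by (intro antisym int nn_integral_mono_AE le)
  have "(\<integral>\<^sup>+x. v x - u x \<partial>M) = (\<integral>\<^sup>+x. v x \<partial>M) - (\<integral>\<^sup>+x. u x \<partial>M)"
    using fin eq le by (intro nn_integral_diff) auto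
  then have "(\<integral>\<^sup>+x. v x - u x \<partial>M) = 0"
    using fin by (simp add: eq)
  then have "AE x in M. v x - u x = 0"
    by (subst (asm) nn_integral_0_iff_AE) auto
  moreover have "AE x in M. v x \<noteq> \<infinity>"
    by (rule nn_integral_PInf_AE) (use fin in auto)
  ultimately show ?thesis
    using le by eventually_elim (auto simp: diff_eq_0_iff_ennreal)
qed

text \<open>The signed version: both expectations coincide and are finite, so the two functions may
  be replaced by integrable real ones, whose nonnegative difference integrates to 0.\<close>

lemma expect_eq_imp_AE_eq:
  assumes f: "f \<in> borel_measurable M" and g: "g \<in> borel_measurable M"
    and le: "AE x in M. f x \<le> g x"
    and int: "expect M g \<le> expect M f" and fin: "\<bar>expect M f\<bar> \<noteq> \<infinity>"
  shows "AE x in M. f x = g x"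
proof -
  have eq: "expect M g = expect M f"
    by (intro antisym int expect_mono_AE le)
  obtain f' where f': "integrable M f'" "AE x in M. f x = ereal (f' x)" "expect M f = ereal (integral\<^sup>L M f')"
    using expect_finiteD[OF f fin] .
  obtain g' where g': "integrable M g'" "AE x in M. g x = ereal (g' x)" "expect M g = ereal (integral\<^sup>L M g')"
    using expect_finiteD[OF g] fin eq by metis
  have "integral\<^sup>L M (\<lambda>x. g' x - f' x) = 0"
    using f' g' eq by simp
  moreover have "AE x in M. 0 \<le> g' x - f' x"
    using f'(2) g'(2) le by eventually_elim auto
  ultimately have "AE x in M. g' x - f' x = 0"
    using f'(1) g'(1) by (subst (asm) integral_nonneg_eq_0_iff_AE) auto
  then show ?thesis
    using f'(2) g'(2) by eventually_elim auto
qed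

text \<open>The new law is \<open>Q\<close> conditioned on the event that \<open>F\<close> exceeds
  its mean. The gain is the integral of \<open>F\<close> minus its mean against the new weight; this
  integrand is nonnegative and is positive on \<open>A\<close>, which is not null.\<close>

lemma expect_less_expect_above_mean:
  fixes F :: "'a \<Rightarrow> ereal"
  assumes "prob_space Q" and F: "F \<in> borel_measurable Q" and fin: "\<bar>expect Q F\<bar> \<noteq> \<infinity>"
  defines "A \<equiv> {z \<in> space Q. expect Q F < F z}"
  assumes pos: "measure Q A \<noteq> 0"
  shows "expect Q F < expect (density Q (\<lambda>z. ennreal (indicator A z / measure Q A))) F"
proof -
  interpret prob_space Q by fact
  have A[measurable]: "A \<in> sets Q" unfolding A_def using F by measurable
  define R where "R = density Q (\<lambda>z. ennreal (indicator A z / measure Q A))"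
  obtain f where f: "integrable Q f" "AE z in Q. F z = ereal (f z)" "expect Q F = ereal (integral\<^sup>L Q f)"
    using expect_finiteD[OF F fin] .
  have [measurable]: "f \<in> borel_measurable Q" using f(1) by auto
  define m where "m = integral\<^sup>L Q f"
  let ?w = "\<lambda>z. indicator A z / measure Q A :: real"
  have iw: "integrable Q (\<lambda>z. ?w z * f z)"
    using integrable_mult_indicator[OF A f(1)] by simp
  have iw1: "integrable Q ?w" "integral\<^sup>L Q ?w = 1"
    using pos by (auto simp: less_top[symmetric])
  have "AE z in R. F z = ereal (f z)"
    unfolding R_def using f(2) by (subst AE_density) auto
  then have "expect R F = expect R (\<lambda>z. ereal (f z))"
    by (rule expect_cong_AE)
  also have "\<dots> = ereal (integral\<^sup>L R f)"
    using iw by (intro expect_integrable) (auto simp: R_def integrable_density)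
  also have "integral\<^sup>L R f = (\<integral>z. ?w z * f z \<partial>Q)"
    unfolding R_def by (subst integral_density) auto
  finally have R: "expect R F = ereal (\<integral>z. ?w z * f z \<partial>Q)" .
  have idiff: "integrable Q (\<lambda>z. ?w z * f z - ?w z * m)"
    using iw iw1(1) by (intro Bochner_Integration.integrable_diff integrable_mult_left)
  have diff: "(\<integral>z. ?w z * f z - ?w z * m \<partial>Q) = (\<integral>z. ?w z * f z \<partial>Q) - m"
    using iw iw1 by (subst Bochner_Integration.integral_diff) (auto simp del: times_divide_eq_left)
  have above: "AE z in Q. z \<in> A \<longrightarrow> m < f z"
    using f(2) by eventually_elim (auto simp: A_def f(3) m_def)
  have nonneg: "AE z in Q. 0 \<le> ?w z * f z - ?w z * m"
    using above by eventually_elim (auto simp: indicator_def divide_simps)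
  have "(\<integral>z. ?w z * f z - ?w z * m \<partial>Q) \<noteq> 0"
  proof
    assume "(\<integral>z. ?w z * f z - ?w z * m \<partial>Q) = 0"
    then have "AE z in Q. ?w z * f z - ?w z * m = 0"
      using idiff nonneg by (subst (asm) integral_nonneg_eq_0_iff_AE) auto
    then have "AE z in Q. z \<notin> A"
      using above by eventually_elim (use pos in \<open>auto simp: indicator_def\<close>)
    then show False
      using pos A by (simp add: AE_iff_measurable[OF A] prob_eq_0)
  qed
  moreover have "(\<integral>z. ?w z * f z - ?w z * m \<partial>Q) \<ge> 0"
    by (rule integral_nonneg_AE[OF nonneg])
  ultimately have "m < (\<integral>z. ?w z * f z \<partial>Q)" using diff by linarith
  then show ?thesis
    unfolding R[unfolded R_def] f(3) m_def by simp
qed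


subsection \<open>Densities\<close>

lemma cond_density_measurable:
  "cond_density A B k \<Longrightarrow> (\<lambda>(x, y). k x y) \<in> borel_measurable (A \<Otimes>\<^sub>M B)"
  by (simp add: cond_density_def)

lemma cond_densityD:
  assumes "cond_density A B k" "x \<in> space A"
  shows "k x \<in> borel_measurable B" "\<And>y. y \<in> space B \<Longrightarrow> 0 \<le> k x y"
    "(\<integral>\<^sup>+y. ennreal (k x y) \<partial>B) = 1"
  using assms by (auto simp: cond_density_def prob_density_def)

lemma sets_law [measurable_cong, simp]: "sets (law M f) = sets M"
  and space_law [simp]: "space (law M f) = space M"
  by (simp_all add: law_def)

lemma prob_space_law:
  assumes "prob_density M f"
  shows "prob_space (law M f)"
  using assms by (intro prob_spaceI) (auto simp: law_def emeasure_density prob_density_def cong: nn_integral_cong)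

lemma prob_space_law_cond:
  assumes "cond_density A B k" "x \<in> space A"
  shows "prob_space (law B (k x))"
  using assms by (intro prob_space_law) (simp add: cond_density_def)

lemma AE_law_iff:
  assumes "f \<in> borel_measurable M"
  shows "(AE x in law M f. P x) \<longleftrightarrow> (AE x in M. 0 < f x \<longrightarrow> P x)"
  unfolding law_def by (subst AE_density) (use assms in auto)

lemma law_cong_AE:
  assumes "f \<in> borel_measurable M" "g \<in> borel_measurable M" "AE x in M. f x = g x"
  shows "law M f = law M g"
  unfolding law_def using assms(1,2) by (intro density_cong) (use assms(3) in \<open>auto elim: eventually_mono\<close>)

lemma expect_law:
  assumes "f \<in> borel_measurable M" "F \<in> borel_measurable M"
  shows "expect (law M f) F =
    (let p = \<integral>\<^sup>+x. ennreal (f x) * e2ennreal (F x) \<partial>M; n = \<integral>\<^sup>+x. ennreal (f x) * e2ennreal (- F x) \<partial>M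
     in if p = \<infinity> \<and> n = \<infinity> then - \<infinity> else enn2ereal p - enn2ereal n)"
  using assms by (simp add: expect_def law_def nn_integral_density)

text \<open>The measure depends on \<open>x\<close>. Moving its density into the integrand leaves
  integrals over the fixed measure \<open>B\<close>, whose measurability in the parameter is
  standard.\<close>

lemma borel_measurable_expect_law:
  fixes F :: "'a \<Rightarrow> 'b \<Rightarrow> ereal"
  assumes "sigma_finite_measure B" and k: "cond_density A B k"
    and F[measurable]: "(\<lambda>(x, z). F x z) \<in> borel_measurable (A \<Otimes>\<^sub>M B)"
  shows "(\<lambda>x. expect (law B (k x)) (F x)) \<in> borel_measurable A"
proof -
  interpret sigma_finite_measure B by fact
  note [measurable] = cond_density_measurable[OF k]
  have "(\<lambda>x. let p = \<integral>\<^sup>+z. ennreal (k x z) * e2ennreal (F x z) \<partial>B;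
       n = \<integral>\<^sup>+z. ennreal (k x z) * e2ennreal (- F x z) \<partial>B
     in if p = \<infinity> \<and> n = \<infinity> then - \<infinity> else enn2ereal p - enn2ereal n) \<in> borel_measurable A"
    unfolding Let_def by measurable
  also have "?this \<longleftrightarrow> ?thesis"
  proof (rule measurable_cong)
    fix x assume [measurable]: "x \<in> space A"
    have "k x \<in> borel_measurable B" "F x \<in> borel_measurable B" by measurable
    then show "(let p = \<integral>\<^sup>+z. ennreal (k x z) * e2ennreal (F x z) \<partial>B;
       n = \<integral>\<^sup>+z. ennreal (k x z) * e2ennreal (- F x z) \<partial>B
     in if p = \<infinity> \<and> n = \<infinity> then - \<infinity> else enn2ereal p - enn2ereal n) = expect (law B (k x)) (F x)"
      by (simp add: expect_law)
  qed
  finally show ?thesis .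
qed

subsection \<open>Best responses\<close>

text \<open>The competitor conditions each \<open>q x\<close> on the event that \<open>F x\<close>
  exceeds its mean. This would be a strict gain wherever that event has positive probability, so the
  event is null for almost every \<open>x\<close>.\<close>

lemma best_response_constant:
  fixes F :: "'a \<Rightarrow> 'b \<Rightarrow> ereal"
  assumes B: "sigma_finite_measure B" and q: "cond_density A B q"
    and F[measurable]: "(\<lambda>(x, z). F x z) \<in> borel_measurable (A \<Otimes>\<^sub>M B)"
    and fin: "\<bar>expect A (\<lambda>x. expect (law B (q x)) (F x))\<bar> \<noteq> \<infinity>"
    and best: "\<And>r. cond_density A B r \<Longrightarrow>
      expect A (\<lambda>x. expect (law B (r x)) (F x)) \<le> expect A (\<lambda>x. expect (law B (q x)) (F x))"
  shows "AE x in A. \<bar>expect (law B (q x)) (F x)\<bar> \<noteq> \<infinity> \<and>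
    (AE z in law B (q x). F x z = expect (law B (q x)) (F x))"
proof -
  interpret sigma_finite_measure B by fact
  define h where "h x = expect (law B (q x)) (F x)" for x
  define S where "S x = {z \<in> space B. h x < F x z}" for x
  define \<alpha> where "\<alpha> x = measure (law B (q x)) (S x)" for x
  \<comment> \<open>Here \<open>h x\<close> is the mean of \<open>F x\<close> under
    \<open>q x\<close>, and \<open>\<alpha> x\<close> is the probability of exceeding it. Where
    conditioning is impossible or the mean is infinite, \<open>q x\<close> is kept.\<close>
  define r where "r x z = (if \<bar>h x\<bar> \<noteq> \<infinity> \<and> \<alpha> x \<noteq> 0
    then q x z * (indicator (S x) z / \<alpha> x) else q x z)" for x z
  note [measurable] = cond_density_measurable[OF q]
  have h[measurable]: "h \<in> borel_measurable A"
    unfolding h_def by (rule borel_measurable_expect_law[OF B q F])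
  have S[measurable]: "S x \<in> sets B" if [measurable]: "x \<in> space A" for x
    unfolding S_def by measurable
  have qx[measurable]: "q x \<in> borel_measurable B" if [measurable]: "x \<in> space A" for x
    by measurable
  have Fx[measurable]: "F x \<in> borel_measurable B" if [measurable]: "x \<in> space A" for x
    by measurable
  \<comment> \<open>The set \<open>S x\<close> varies with \<open>x\<close>; writing its indicator
    as the condition \<open>h x < F x z\<close> makes joint measurability visible.\<close>
  have "(\<lambda>x. enn2real (\<integral>\<^sup>+z. ennreal (q x z) * (if h x < F x z then 1 else 0) \<partial>B)) \<in> borel_measurable A"
    by measurable
  also have "?this \<longleftrightarrow> \<alpha> \<in> borel_measurable A"
  proof (rule measurable_cong)
    fix x assume x: "x \<in> space A"
    have "emeasure (law B (q x)) (S x) = (\<integral>\<^sup>+z. ennreal (q x z) * indicator (S x) z \<partial>B)"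
      unfolding law_def using x by (subst emeasure_density) auto
    also have "\<dots> = (\<integral>\<^sup>+z. ennreal (q x z) * (if h x < F x z then 1 else 0) \<partial>B)"
      by (intro nn_integral_cong) (auto simp: S_def)
    finally show "enn2real (\<integral>\<^sup>+z. ennreal (q x z) * (if h x < F x z then 1 else 0) \<partial>B) = \<alpha> x"
      by (simp add: \<alpha>_def measure_def)
  qed
  finally have \<alpha>[measurable]: "\<alpha> \<in> borel_measurable A" .
  have r_law: "law B (r x) = density (law B (q x)) (\<lambda>z. ennreal (indicator (S x) z / \<alpha> x))"
    if x: "x \<in> space A" and "\<bar>h x\<bar> \<noteq> \<infinity>" "\<alpha> x \<noteq> 0" for x
  proof -
    have "density (law B (q x)) (\<lambda>z. ennreal (indicator (S x) z / \<alpha> x)) =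
        density B (\<lambda>z. ennreal (q x z) * ennreal (indicator (S x) z / \<alpha> x))"
      unfolding law_def using x by (intro density_density_eq) measurable
    also have "\<dots> = law B (r x)"
      unfolding law_def
    proof (rule density_cong)
      show "AE z in B. ennreal (q x z) * ennreal (indicator (S x) z / \<alpha> x) = ennreal (r x z)"
        using that cond_densityD(2)[OF q x]
        by (intro AE_I2, subst ennreal_mult[symmetric]) (auto simp: r_def \<alpha>_def)
      show "(\<lambda>z. ennreal (r x z)) \<in> borel_measurable B"
        using x unfolding r_def by measurable
    qed (use x in measurable)
    finally show ?thesis ..
  qed
  have r: "cond_density A B r"
    unfolding cond_density_def
  proof (intro conjI ballI)
    have "(\<lambda>(x, z). if \<bar>h x\<bar> \<noteq> \<infinity> \<and> \<alpha> x \<noteq> 0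
       then q x z * ((if h x < F x z then 1 else 0) / \<alpha> x) else q x z) \<in> borel_measurable (A \<Otimes>\<^sub>M B)"
      by measurable
    also have "?this \<longleftrightarrow> (\<lambda>(x, z). r x z) \<in> borel_measurable (A \<Otimes>\<^sub>M B)"
      by (rule measurable_cong) (auto simp: r_def S_def space_pair_measure)
    finally show "(\<lambda>(x, z). r x z) \<in> borel_measurable (A \<Otimes>\<^sub>M B)" .
    fix x assume x: "x \<in> space A"
    interpret Q: prob_space "law B (q x)"
      by (rule prob_space_law_cond[OF q x])
    show "prob_density B (r x)"
    proof (cases "\<bar>h x\<bar> \<noteq> \<infinity> \<and> \<alpha> x \<noteq> 0")
      case True
      have rx[measurable]: "r x \<in> borel_measurable B"
        using x unfolding r_def by measurable
      have "(\<integral>\<^sup>+z. ennreal (r x z) \<partial>B) = emeasure (law B (r x)) (space B)"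
        unfolding law_def by (subst emeasure_density) (auto cong: nn_integral_cong)
      also have "\<dots> = (\<integral>\<^sup>+z. ennreal (indicator (S x) z / \<alpha> x) \<partial>law B (q x))"
        using x True by (subst r_law) (auto simp: emeasure_density intro!: nn_integral_cong)
      also have "\<dots> = (\<integral>\<^sup>+z. ennreal (1 / \<alpha> x) * indicator (S x) z \<partial>law B (q x))"
        by (intro nn_integral_cong) (auto simp: indicator_def)
      also have "\<dots> = ennreal (1 / \<alpha> x) * emeasure (law B (q x)) (S x)"
        using x by (subst nn_integral_cmult_indicator) auto
      also have "\<dots> = 1"
        using True by (simp add: Q.emeasure_eq_measure \<alpha>_def ennreal_mult[symmetric])
      finally show ?thesis
        using True cond_densityD(2)[OF q x] rx by (auto simp: prob_density_def r_def \<alpha>_def)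
    next
      case False
      then have "r x = q x" by (auto simp: r_def)
      then show ?thesis using q x by (simp add: cond_density_def)
    qed
  qed
  define h' where "h' x = expect (law B (r x)) (F x)" for x
  have h'[measurable]: "h' \<in> borel_measurable A"
    unfolding h'_def by (rule borel_measurable_expect_law[OF B r F])
  have less: "h x < h' x" if x: "x \<in> space A" and *: "\<bar>h x\<bar> \<noteq> \<infinity>" "\<alpha> x \<noteq> 0" for x
    using expect_less_expect_above_mean[OF prob_space_law_cond[OF q x], of "F x"] * x
    by (simp add: h'_def r_law h_def S_def \<alpha>_def)
  have same: "h' x = h x" if "\<not> (\<bar>h x\<bar> \<noteq> \<infinity> \<and> \<alpha> x \<noteq> 0)" for x
  proof -
    have "r x = q x" using that by (auto simp: r_def)
    then show ?thesis by (simp add: h'_def h_def)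
  qed
  have le: "AE x in A. h x \<le> h' x"
    using less same by (intro AE_I2) (metis less_imp_le order_refl)
  \<comment> \<open>The competitor is at least as good at every \<open>x\<close>, and by optimality
    it is not better on average.\<close>
  have eq: "AE x in A. h x = h' x"
    using best[OF r] fin by (intro expect_eq_imp_AE_eq[OF h h' le]) (simp_all add: h_def h'_def)
  obtain g where "AE x in A. h x = ereal (g x)"
    using expect_finiteD[OF h fin[folded h_def]] .
  then have "AE x in A. \<bar>h x\<bar> \<noteq> \<infinity>"
    by eventually_elim simp
  then show ?thesis
    using eq AE_space unfolding h_def[symmetric]
  proof eventually_elim
    case (elim x)
    interpret Q: prob_space "law B (q x)"
      by (rule prob_space_law_cond[OF q]) (use elim in simp)
    \<comment> \<open>A positive \<open>\<alpha> x\<close> would give \<open>h x < h' x\<close>. So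
      \<open>F x\<close> almost never exceeds its mean \<open>h x\<close>, and a function bounded by
      its finite mean equals it almost everywhere.\<close>
    have "\<alpha> x = 0"
      using less[OF elim(3,1)] elim(2) by (metis less_irrefl)
    then have "AE z in law B (q x). z \<notin> S x"
      using elim S[of x] by (subst (asm) \<alpha>_def, subst (asm) Q.prob_eq_0) auto
    then have "AE z in law B (q x). F x z \<le> h x"
      using AE_space by eventually_elim (auto simp: S_def)
    moreover have "expect (law B (q x)) (\<lambda>z. h x) = h x"
    proof -
      obtain c where c: "h x = ereal c"
        using elim(1) by auto
      show ?thesis
        unfolding c by (subst expect_integrable) (simp_all add: Q.prob_space del: space_law)
    qed
    ultimately have "AE z in law B (q x). F x z = h x"
      using Fx[OF elim(3)] elim(1) by (intro expect_eq_imp_AE_eq) (simp_all add: h_def)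
    then show ?case
      using elim by simp
  qed
qed

section \<open>The optimal discriminator\<close>

text \<open>Gibbs' inequality for two Bernoulli distributions with success probabilities
  \<open>sigma s = a / (a + b)\<close> and \<open>sigma t\<close>. It follows from
  \<open>ln y \<le> y - 1\<close>, whose equality case \<open>y = 1\<close> gives
  uniqueness.\<close>

lemma logistic_loss_minimizer:
  fixes a b t :: real
  assumes "0 < a" "0 < b"
  defines "s \<equiv> ln (a / b)"
  shows "a * ln (1 + exp (- s)) + b * ln (1 + exp s) \<le> a * ln (1 + exp (- t)) + b * ln (1 + exp t)" (is ?le)
    and "a * ln (1 + exp (- s)) + b * ln (1 + exp s) = a * ln (1 + exp (- t)) + b * ln (1 + exp t)
      \<Longrightarrow> t = s"
proof -
  \<comment> \<open>These are the likelihood ratios \<open>u = sigma t / sigma s\<close> and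
    \<open>v = (1 - sigma t) / (1 - sigma s)\<close>.\<close>
  define u where "u = (1 + exp (- s)) / (1 + exp (- t))"
  define v where "v = (1 + exp s) / (1 + exp t)"
  have pos: "0 < 1 + exp x" for x :: real
    by (simp add: add_pos_pos)
  have uv: "0 < u" "0 < v"
    using pos by (simp_all add: u_def v_def)
  have s: "exp s = a / b" "exp (- s) = b / a"
    using assms by (simp_all add: s_def exp_minus)
  \<comment> \<open>Because \<open>a * u = (a + b) * sigma t\<close> and
    \<open>b * v = (a + b) * (1 - sigma t)\<close>, the linear bounds on the logarithms
    cancel.\<close>
  have sum: "a * (u - 1) + b * (v - 1) = 0"
  proof -
    have "1 + exp (- t) = (1 + exp t) / exp t"
      by (simp add: exp_minus field_simps)
    then have "u = (1 + b / a) / ((1 + exp t) / exp t)"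
      by (simp only: u_def s)
    then have "u = (a + b) * (exp t / (1 + exp t)) / a"
      using assms(1,2) by (simp add: field_simps)
    then have "a * u = (a + b) * (exp t / (1 + exp t))"
      using assms(1) by simp
    moreover have "v = (1 + a / b) / (1 + exp t)"
      by (simp only: v_def s)
    then have "b * v = (a + b) * (1 / (1 + exp t))"
      using assms(2) by (simp add: distrib_left)
    moreover have "exp t / (1 + exp t) + 1 / (1 + exp t) = 1"
      using pos[of t] by (simp add: add_divide_distrib[symmetric] add.commute)
    ultimately have "a * u + b * v = a + b"
      by (metis distrib_left mult.right_neutral)
    then show ?thesis
      by (simp add: right_diff_distrib)
  qed
  have ln: "ln u = ln (1 + exp (- s)) - ln (1 + exp (- t))" "ln v = ln (1 + exp s) - ln (1 + exp t)"
    using pos[of s] pos[of "-s"] pos[of t] pos[of "-t"] by (simp_all add: u_def v_def ln_div)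
  have u: "a * ln u \<le> a * (u - 1)" and v: "b * ln v \<le> b * (v - 1)"
    using assms uv by (simp_all add: ln_le_minus_one)
  then show ?le
    using sum unfolding ln by (simp add: algebra_simps)
  assume "a * ln (1 + exp (- s)) + b * ln (1 + exp s) = a * ln (1 + exp (- t)) + b * ln (1 + exp t)"
  then have "b * ln v = b * (v - 1)"
    using u v sum unfolding ln by (simp add: algebra_simps)
  then have "ln v = v - 1"
    using assms by simp
  then have "v = 1"
    using uv ln_eq_minus_one by blast
  then show "t = s"
    using pos[of t] by (simp add: v_def)
qed

lemma ln_sigma: "ln (sigma t) = - ln (1 + exp (- t))"
  and ln_one_minus_sigma: "ln (1 - sigma t) = - ln (1 + exp t)"
proof -
  have pos: "0 < 1 + exp x" for x :: real
    by (simp add: add_pos_pos)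
  show "ln (sigma t) = - ln (1 + exp (- t))"
    using pos[of "-t"] by (simp add: sigma_def ln_inverse)
  have "1 - sigma t = inverse (1 + exp t)"
    using pos[of "-t"] pos[of t] by (simp add: sigma_def field_simps exp_minus)
  then show "ln (1 - sigma t) = - ln (1 + exp t)"
    using pos[of t] by (simp add: ln_inverse)
qed

text \<open>The sign is flipped so that nonnegative integrals apply; \<open>a\<close> and
  \<open>b\<close> stand for the values of \<open>q\<close> and of the prior.\<close>

definition disc_loss :: "real \<Rightarrow> real \<Rightarrow> real \<Rightarrow> real" where
  "disc_loss a b t = a * ln (1 + exp (- t)) + b * ln (1 + exp t)"

text \<open>A strictly better discriminator value than \<open>t\<close>, unless \<open>t\<close> is already optimal. If exactly one
  weight is positive the loss is strictly monotone in \<open>t\<close>, so moving by \<open>1\<close> improves it.\<close>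
definition disc_step :: "real \<Rightarrow> real \<Rightarrow> real \<Rightarrow> real" where
  "disc_step a b t =
    (if 0 < a \<and> 0 < b then ln (a / b) else if 0 < a then t + 1 else if 0 < b then t - 1 else t)"

lemma disc_loss_nonneg: "0 \<le> a \<Longrightarrow> 0 \<le> b \<Longrightarrow> 0 \<le> disc_loss a b t"
  by (simp add: disc_loss_def)

lemma disc_step_le:
  assumes "0 \<le> a" "0 \<le> b"
  shows "disc_loss a b (disc_step a b t) \<le> disc_loss a b t"
  using assms logistic_loss_minimizer(1)[of a b t]
  by (auto simp: disc_loss_def disc_step_def add_pos_pos intro!: mult_left_mono)

lemma disc_step_eq:
  assumes "0 \<le> a" "0 \<le> b" "disc_loss a b (disc_step a b t) = disc_loss a b t"
  shows "(0 < a \<longleftrightarrow> 0 < b) \<and> (0 < a \<longrightarrow> t = ln (a / b))"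
proof -
  have pos: "0 < 1 + exp x" for x :: real
    by (simp add: add_pos_pos)
  show ?thesis
    using assms logistic_loss_minimizer(2)[of a b t] pos
    by (auto simp: disc_loss_def disc_step_def split: if_splits)
qed

lemma expect_uminus_nn_integral:
  assumes "\<And>x. x \<in> space M \<Longrightarrow> f x = - enn2ereal (g x)"
  shows "expect M f = - enn2ereal (\<integral>\<^sup>+x. g x \<partial>M)"
proof -
  have "expect M f = expect M (\<lambda>x. - enn2ereal (g x))"
    using assms by (rule expect_cong)
  then show ?thesis
    by (simp add: expect_nonpos)
qed

text \<open>Both expectations have nonpositive integrands, so neither is undefined and their sum
  involves no \<open>\<infinity> - \<infinity>\<close>. This allows merging them into one integral
  even when the payoff is \<open>-\<infinity>\<close>.\<close>

lemma payoff1_eq: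
  assumes MZ: "sigma_finite_measure MZ" and prior: "prob_density MZ prior"
    and q: "cond_density MX MZ q" and T: "(\<lambda>(x, z). T x z) \<in> borel_measurable (MX \<Otimes>\<^sub>M MZ)"
  shows "payoff1 (law MX pD) (law MZ prior) (\<lambda>x. law MZ (q x)) T =
    - enn2ereal (\<integral>\<^sup>+x. (\<integral>\<^sup>+z. ennreal (disc_loss (q x z) (prior z) (T x z)) \<partial>MZ) \<partial>law MX pD)"
proof -
  interpret sigma_finite_measure MZ by fact
  note [measurable] = T cond_density_measurable[OF q]
  have [measurable]: "prior \<in> borel_measurable MZ"
    using prior by (simp add: prob_density_def)
  let ?a = "\<lambda>x z. q x z * ln (1 + exp (- T x z))" and ?b = "\<lambda>x z. prior z * ln (1 + exp (T x z))"
  have A: "expect (law MX pD) (\<lambda>x. expect (law MZ (q x)) (\<lambda>z. ereal (ln (sigma (T x z))))) =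
    - enn2ereal (\<integral>\<^sup>+x. (\<integral>\<^sup>+z. ennreal (?a x z) \<partial>MZ) \<partial>law MX pD)"
  proof (rule expect_uminus_nn_integral)
    fix x assume "x \<in> space (law MX pD)"
    then have x[measurable]: "x \<in> space MX" by simp
    have "expect (law MZ (q x)) (\<lambda>z. ereal (ln (sigma (T x z)))) =
       - enn2ereal (\<integral>\<^sup>+z. ennreal (ln (1 + exp (- T x z))) \<partial>law MZ (q x))"
      by (rule expect_uminus_nn_integral) (simp add: ln_sigma enn2ereal_ennreal)
    also have "(\<integral>\<^sup>+z. ennreal (ln (1 + exp (- T x z))) \<partial>law MZ (q x)) = (\<integral>\<^sup>+z. ennreal (?a x z) \<partial>MZ)"
      unfolding law_def using cond_densityD(2)[OF q x]
      by (subst nn_integral_density) (auto simp: ennreal_mult intro!: nn_integral_cong)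
    finally show "expect (law MZ (q x)) (\<lambda>z. ereal (ln (sigma (T x z)))) =
      - enn2ereal (\<integral>\<^sup>+z. ennreal (?a x z) \<partial>MZ)" .
  qed
  have B: "expect (law MX pD) (\<lambda>x. expect (law MZ prior) (\<lambda>z. ereal (ln (1 - sigma (T x z))))) =
    - enn2ereal (\<integral>\<^sup>+x. (\<integral>\<^sup>+z. ennreal (?b x z) \<partial>MZ) \<partial>law MX pD)"
  proof (rule expect_uminus_nn_integral)
    fix x assume "x \<in> space (law MX pD)"
    then have x[measurable]: "x \<in> space MX" by simp
    have "expect (law MZ prior) (\<lambda>z. ereal (ln (1 - sigma (T x z)))) =
       - enn2ereal (\<integral>\<^sup>+z. ennreal (ln (1 + exp (T x z))) \<partial>law MZ prior)"
      by (rule expect_uminus_nn_integral) (simp add: ln_one_minus_sigma enn2ereal_ennreal)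
    also have "(\<integral>\<^sup>+z. ennreal (ln (1 + exp (T x z))) \<partial>law MZ prior) = (\<integral>\<^sup>+z. ennreal (?b x z) \<partial>MZ)"
      unfolding law_def using prior
      by (subst nn_integral_density) (auto simp: ennreal_mult prob_density_def intro!: nn_integral_cong)
    finally show "expect (law MZ prior) (\<lambda>z. ereal (ln (1 - sigma (T x z)))) =
      - enn2ereal (\<integral>\<^sup>+z. ennreal (?b x z) \<partial>MZ)" .
  qed
  have "(\<integral>\<^sup>+x. (\<integral>\<^sup>+z. ennreal (disc_loss (q x z) (prior z) (T x z)) \<partial>MZ) \<partial>law MX pD) =
    (\<integral>\<^sup>+x. (\<integral>\<^sup>+z. ennreal (?a x z) \<partial>MZ) + (\<integral>\<^sup>+z. ennreal (?b x z) \<partial>MZ) \<partial>law MX pD)"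
  proof (rule nn_integral_cong)
    fix x assume "x \<in> space (law MX pD)"
    then have x[measurable]: "x \<in> space MX" by simp
    have "(\<integral>\<^sup>+z. ennreal (disc_loss (q x z) (prior z) (T x z)) \<partial>MZ) =
      (\<integral>\<^sup>+z. ennreal (?a x z) + ennreal (?b x z) \<partial>MZ)"
      using cond_densityD(2)[OF q x] prior
      by (intro nn_integral_cong) (simp add: disc_loss_def prob_density_def)
    then show "(\<integral>\<^sup>+z. ennreal (disc_loss (q x z) (prior z) (T x z)) \<partial>MZ) =
      (\<integral>\<^sup>+z. ennreal (?a x z) \<partial>MZ) + (\<integral>\<^sup>+z. ennreal (?b x z) \<partial>MZ)"
      by (simp add: nn_integral_add)
  qed
  also have "\<dots> = (\<integral>\<^sup>+x. (\<integral>\<^sup>+z. ennreal (?a x z) \<partial>MZ) \<partial>law MX pD) +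
      (\<integral>\<^sup>+x. (\<integral>\<^sup>+z. ennreal (?b x z) \<partial>MZ) \<partial>law MX pD)"
    by (rule nn_integral_add) measurable
  moreover have "- enn2ereal a + - enn2ereal b = - enn2ereal (a + b)" for a b
    by (cases a; cases b) (auto simp flip: ennreal_plus)
  ultimately show ?thesis
    unfolding payoff1_def A B by simp
qed

text \<open>Applying \<open>disc_step\<close> at every point gives an admissible competitor with
  pointwise no larger loss. Optimality forces equal losses, first for almost every \<open>x\<close>
  after integrating over \<open>z\<close>, then for almost every \<open>z\<close>.\<close>

lemma optimal_discriminator:
  assumes MZ: "sigma_finite_measure MZ" and data: "prob_density MX pD"
    and prior: "prob_density MZ prior" and q: "cond_density MX MZ q"
    and opt: "is_arg_max (payoff1 (law MX pD) (law MZ prior) (\<lambda>x. law MZ (q x)))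
       (\<lambda>T. (\<lambda>(x, z). T x z) \<in> borel_measurable (MX \<Otimes>\<^sub>M MZ)) T"
  shows "AE x in law MX pD. AE z in MZ.
    (0 < q x z \<longleftrightarrow> 0 < prior z) \<and> (0 < q x z \<longrightarrow> T x z = ln (q x z / prior z))"
proof -
  interpret sigma_finite_measure MZ by fact
  interpret D: prob_space "law MX pD" by (rule prob_space_law[OF data])
  have T[measurable]: "(\<lambda>(x, z). T x z) \<in> borel_measurable (MX \<Otimes>\<^sub>M MZ)"
    using opt by (simp add: is_arg_max_def)
  note [measurable] = cond_density_measurable[OF q]
  have [measurable]: "prior \<in> borel_measurable MZ" and prior_nonneg: "\<And>z. z \<in> space MZ \<Longrightarrow> 0 \<le> prior z"
    using prior by (simp_all add: prob_density_def)
  define T' where "T' x z = disc_step (q x z) (prior z) (T x z)" for x z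
  have T'[measurable]: "(\<lambda>(x, z). T' x z) \<in> borel_measurable (MX \<Otimes>\<^sub>M MZ)"
    unfolding T'_def disc_step_def by measurable
  let ?L = "\<lambda>T x. \<integral>\<^sup>+z. ennreal (disc_loss (q x z) (prior z) (T x z)) \<partial>MZ"
  have best: "(\<integral>\<^sup>+x. ?L T x \<partial>law MX pD) \<le> (\<integral>\<^sup>+x. ?L U x \<partial>law MX pD)"
    if "(\<lambda>(x, z). U x z) \<in> borel_measurable (MX \<Otimes>\<^sub>M MZ)" for U
  proof -
    have "payoff1 (law MX pD) (law MZ prior) (\<lambda>x. law MZ (q x)) U \<le>
      payoff1 (law MX pD) (law MZ prior) (\<lambda>x. law MZ (q x)) T"
      using opt that by (auto simp: is_arg_max_def not_less)
    then show ?thesis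
      using payoff1_eq[OF MZ prior q that] payoff1_eq[OF MZ prior q T]
      by (simp add: less_eq_ennreal.rep_eq)
  qed
  \<comment> \<open>The zero discriminator has loss \<open>2 * ln 2\<close> at every
    \<open>x\<close>, which bounds the optimal loss.\<close>
  have fin: "(\<integral>\<^sup>+x. ?L T x \<partial>law MX pD) \<noteq> \<infinity>"
  proof -
    have "?L (\<lambda>_ _. 0) x = ennreal (ln 2) * 2" if x[measurable]: "x \<in> space MX" for x
    proof -
      have "?L (\<lambda>_ _. 0) x = (\<integral>\<^sup>+z. ennreal (ln 2) * (ennreal (q x z) + ennreal (prior z)) \<partial>MZ)"
        using cond_densityD(2)[OF q x] prior_nonneg
        by (intro nn_integral_cong)
           (simp add: disc_loss_def ennreal_mult[symmetric] ennreal_plus[symmetric] algebra_simps del: ennreal_plus)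
      also have "\<dots> = ennreal (ln 2) * 2"
        using cond_densityD(3)[OF q x] prior
        by (subst nn_integral_cmult) (auto simp: nn_integral_add prob_density_def)
      finally show ?thesis .
    qed
    then have "(\<integral>\<^sup>+x. ?L (\<lambda>_ _. 0) x \<partial>law MX pD) = (\<integral>\<^sup>+x. ennreal (ln 2) * 2 \<partial>law MX pD)"
      by (intro nn_integral_cong) simp
    also have "\<dots> < \<infinity>"
      by (simp add: D.emeasure_space_1 ennreal_mult_less_top del: space_law)
    finally show ?thesis
      using best[of "\<lambda>_ _. 0"] by auto
  qed
  have pointwise: "ennreal (disc_loss (q x z) (prior z) (T' x z)) \<le> ennreal (disc_loss (q x z) (prior z) (T x z))"
    if "x \<in> space MX" "z \<in> space MZ" for x z
    using disc_step_le[OF cond_densityD(2)[OF q that] prior_nonneg[OF that(2)]]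
    by (simp add: T'_def ennreal_leI)
  have meas[measurable]: "?L U \<in> borel_measurable (law MX pD)"
    if [measurable]: "(\<lambda>(x, z). U x z) \<in> borel_measurable (MX \<Otimes>\<^sub>M MZ)" for U
    unfolding disc_loss_def by measurable
  have "AE x in law MX pD. ?L T' x = ?L T x"
    using best[OF T'] fin pointwise
    by (intro nn_integral_eq_imp_AE_eq meas T T') (auto intro!: nn_integral_mono)
  moreover have "AE x in law MX pD. ?L T x \<noteq> \<infinity>"
    by (rule nn_integral_PInf_AE) (use fin meas[OF T] in auto)
  ultimately show ?thesis
    using AE_space
  proof eventually_elim
    case (elim x)
    then have x[measurable]: "x \<in> space MX" by simp
    have "AE z in MZ. ennreal (disc_loss (q x z) (prior z) (T' x z)) = ennreal (disc_loss (q x z) (prior z) (T x z))"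
      using elim pointwise[OF x]
      by (intro nn_integral_eq_imp_AE_eq) (auto simp: disc_loss_def)
    then show ?case
      using AE_space
    proof eventually_elim
      case (elim z)
      note nn = cond_densityD(2)[OF q x elim(2)] prior_nonneg[OF elim(2)]
      show ?case
        using elim nn by (intro disc_step_eq) (auto simp: T'_def disc_loss_nonneg)
    qed
  qed
qed


section \<open>The evidence bound and the reparameterized payoff\<close>

lemma cond_density_law [simp]: "cond_density (law A f) B k \<longleftrightarrow> cond_density A B k"
  unfolding cond_density_def
  by (simp cong: measurable_cong_sets add: sets_pair_measure_cong[OF sets_law refl])

lemma borel_measurable_elog [measurable]: "elog \<in> borel_measurable borel"
  unfolding elog_def by measurable

text \<open>Here \<open>l\<close> is the likelihood of a fixed observation and \<open>m\<close> its
  evidence. On the support of the posterior \<open>r\<close>, the integrand equals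
  \<open>ln m + ln (r z / q z)\<close>, so the expectation is \<open>ln m\<close> plus the
  divergence of \<open>r\<close> from \<open>q\<close>.\<close>

lemma log_evidence_le_expect_posterior:
  fixes l :: "'z \<Rightarrow> real"
  assumes prior: "prob_density M prior" and q: "prob_density M q"
    and l[measurable]: "l \<in> borel_measurable M" and l_nonneg: "\<And>z. z \<in> space M \<Longrightarrow> 0 \<le> l z"
    and m_pos: "0 < (\<integral>z. l z * prior z \<partial>M)"
    and T: "AE z in M. (0 < q z \<longleftrightarrow> 0 < prior z) \<and> (0 < q z \<longrightarrow> T z = ln (q z / prior z))"
  defines "m \<equiv> \<integral>z. l z * prior z \<partial>M"
  shows "ereal (ln m) \<le> expect (law M (\<lambda>z. l z * prior z / m)) (\<lambda>z. ereal (- T z) + elog (l z))"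
proof -
  have [measurable]: "prior \<in> borel_measurable M" "q \<in> borel_measurable M"
    using prior q by (simp_all add: prob_density_def)
  have nonneg: "0 \<le> prior z" "0 \<le> q z" if "z \<in> space M" for z
    using prior q that by (simp_all add: prob_density_def)
  have m: "0 < m" using m_pos by (simp add: m_def)
  define r where "r z = l z * prior z / m" for z
  have [measurable]: "r \<in> borel_measurable M"
    unfolding r_def by measurable
  have r_nonneg: "0 \<le> r z" if "z \<in> space M" for z
    using nonneg[OF that] l_nonneg[OF that] m by (simp add: r_def)
  \<comment> \<open>A non-integrable function would have Bochner integral 0, against positivity of
    \<open>m\<close>.\<close>
  have "integrable M (\<lambda>z. l z * prior z)"
    using m_pos not_integrable_integral_eq by fastforce
  then have r: "integrable M r" "integral\<^sup>L M r = 1"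
    using m_pos unfolding r_def[abs_def] m_def by simp_all
  have q_int: "integrable M q" "integral\<^sup>L M q = 1"
  proof -
    have "has_bochner_integral M q 1"
      using q by (intro has_bochner_integral_nn_integral) (auto simp: prob_density_def intro!: AE_I2)
    then show "integrable M q" "integral\<^sup>L M q = 1"
      by (simp_all add: has_bochner_integral_iff)
  qed
  \<comment> \<open>The product \<open>r z * (q z / r z)\<close> is \<open>q z\<close> only on the
    support of \<open>r\<close> and 0 elsewhere. The lost mass only helps, since \<open>q'\<close>
    enters with a minus sign.\<close>
  define q' where "q' z = (if 0 < r z then q z else 0)" for z
  have [measurable]: "q' \<in> borel_measurable M"
    unfolding q'_def by measurable
  have q': "integrable M q'"
    by (rule Bochner_Integration.integrable_bound[OF q_int(1)]) (auto simp: q'_def)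
  have "integral\<^sup>L M q' \<le> 1"
    unfolding q_int(2)[symmetric] using q' q_int(1) nonneg
    by (intro integral_mono) (auto simp: q'_def)
  \<comment> \<open>\<open>ln y \<le> y - 1\<close> at \<open>y = q / r\<close> gives a lower bound with a finite integral, so that a possibly
    infinite Kullback-Leibler divergence of \<open>r\<close> from \<open>q\<close> needs no separate treatment.\<close>
  define G where "G z = ln m + 1 - q z / r z" for z
  have [measurable]: "G \<in> borel_measurable M"
    unfolding G_def by measurable
  have rG: "r z * G z = (ln m + 1) * r z - q' z" if "z \<in> space M" for z
    using r_nonneg[OF that] by (auto simp: G_def q'_def field_simps)
  have int_rG: "integrable M (\<lambda>z. r z * G z)"
    using r(1) q' by (subst Bochner_Integration.integrable_cong[OF refl rG]) auto
  have "integrable (law M r) G"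
    unfolding law_def using int_rG r_nonneg by (subst integrable_density) (auto intro!: AE_I2)
  then have "expect (law M r) (\<lambda>z. ereal (G z)) = ereal (integral\<^sup>L (law M r) G)"
    by (rule expect_integrable)
  also have "integral\<^sup>L (law M r) G = (\<integral>z. r z * G z \<partial>M)"
    unfolding law_def using r_nonneg by (subst integral_density) (auto intro!: AE_I2)
  also have "\<dots> = (\<integral>z. (ln m + 1) * r z - q' z \<partial>M)"
    by (rule Bochner_Integration.integral_cong[OF refl rG])
  also have "\<dots> = ln m + 1 - integral\<^sup>L M q'"
    using r q' by simp
  finally have "ereal (ln m) \<le> expect (law M r) (\<lambda>z. ereal (G z))"
    using \<open>integral\<^sup>L M q' \<le> 1\<close> by simp
  also have "\<dots> \<le> expect (law M r) (\<lambda>z. ereal (- T z) + elog (l z))"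
  proof (rule expect_mono_AE)
    have "AE z in M. 0 < r z \<longrightarrow> ereal (G z) \<le> ereal (- T z) + elog (l z)"
      using T AE_space
    proof eventually_elim
      case (elim z)
      show ?case
      proof
        assume rz: "0 < r z"
        then have pos: "0 < l z" "0 < prior z"
          using nonneg[of z] l_nonneg[of z] elim m
          by (auto simp: r_def zero_less_divide_iff zero_less_mult_iff)
        then have qz: "0 < q z" and Tz: "T z = ln (q z / prior z)" using elim by auto
        have "ln (q z / r z) \<le> q z / r z - 1"
          using qz rz by (intro ln_le_minus_one) simp
        moreover have "ln (q z / r z) = ln m + T z - ln (l z)"
          using pos qz m by (simp add: r_def Tz ln_div ln_mult)
        ultimately show "ereal (G z) \<le> ereal (- T z) + elog (l z)"
          using pos by (simp add: G_def elog_def)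
      qed
    qed
    then show "AE z in law M r. ereal (G z) \<le> ereal (- T z) + elog (l z)"
      by (subst AE_law_iff) auto
  qed
  finally show ?thesis
    by (simp add: r_def[abs_def])
qed

text \<open>Change of variables along the reparameterization; afterwards the inference parameter
  enters only through the law it induces.\<close>

lemma payoff2_eq:
  assumes N: "\<And>x. x \<in> space MX \<Longrightarrow> \<zeta> x \<in> measurable N MZ"
    and distr: "\<And>x. x \<in> space MX \<Longrightarrow> distr N MZ (\<zeta> x) = law MZ (q x)"
    and F: "(\<lambda>(x, z). ereal (- T x z) + elog (g x z)) \<in> borel_measurable (MX \<Otimes>\<^sub>M MZ)"
  shows "payoff2 (law MX pD) N g \<zeta> T =
    expect (law MX pD) (\<lambda>x. expect (law MZ (q x)) (\<lambda>z. ereal (- T x z) + elog (g x z)))"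
  unfolding payoff2_def
proof (rule expect_cong)
  fix x assume "x \<in> space (law MX pD)"
  then have x[measurable]: "x \<in> space MX" by simp
  note [measurable] = F
  have "(\<lambda>z. ereal (- T x z) + elog (g x z)) \<in> borel_measurable MZ" by measurable
  from expect_distr[OF N[OF x] this]
  show "expect N (\<lambda>\<epsilon>. ereal (- T x (\<zeta> x \<epsilon>)) + elog (g x (\<zeta> x \<epsilon>))) =
    expect (law MZ (q x)) (\<lambda>z. ereal (- T x z) + elog (g x z))"
    by (simp add: distr[OF x])
qed

section \<open>The three claims at equilibrium\<close>

theorem corollary4:
  fixes MX :: "'x measure" and MZ :: "'z measure" and N :: "'e measure"
    and pD :: "'x \<Rightarrow> real" and prior :: "'z \<Rightarrow> real"
    and \<Theta> :: "'t set" and p :: "'t \<Rightarrow> 'x \<Rightarrow> 'z \<Rightarrow> real"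
    and \<Phi> :: "'f set" and q :: "'f \<Rightarrow> 'x \<Rightarrow> 'z \<Rightarrow> real" and \<zeta> :: "'f \<Rightarrow> 'x \<Rightarrow> 'e \<Rightarrow> 'z"
    and \<theta>s :: 't and \<phi>s :: 'f and Ts :: "'x \<Rightarrow> 'z \<Rightarrow> real"
  assumes "sigma_finite_measure MX" and "sigma_finite_measure MZ" and "prob_space N"
    and data: "prob_density MX pD"
    and prior: "prob_density MZ prior"
    and generative: "\<And>\<theta>. \<theta> \<in> \<Theta> \<Longrightarrow> cond_density MZ MX (\<lambda>z x. p \<theta> x z)"
    and inference: "\<And>\<phi>. \<phi> \<in> \<Phi> \<Longrightarrow> cond_density MX MZ (q \<phi>)"
    and reparam_measurable: "\<And>\<phi> x. \<phi> \<in> \<Phi> \<Longrightarrow> x \<in> space MX \<Longrightarrow> \<zeta> \<phi> x \<in> measurable N MZ"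
    and reparam: "\<And>\<phi> x. \<phi> \<in> \<Phi> \<Longrightarrow> x \<in> space MX \<Longrightarrow> distr N MZ (\<zeta> \<phi> x) = law MZ (q \<phi> x)"
    and universal: "\<And>r. cond_density MX MZ r \<Longrightarrow>
      \<exists>\<phi>\<in>\<Phi>. \<forall>x\<in>space MX. AE z in MZ. q \<phi> x z = r x z"
    and nash: "nash_equilibrium MX MZ N pD prior \<Theta> p \<Phi> q \<zeta> \<theta>s \<phi>s Ts"
    and finite_payoff: "\<bar>payoff2 (law MX pD) N (p \<theta>s) (\<zeta> \<phi>s) Ts\<bar> \<noteq> \<infinity>"
  shows "is_arg_max (\<lambda>\<theta>. expect (law MX pD) (\<lambda>x. elog (marginal MZ prior (p \<theta>) x)))
        (\<lambda>\<theta>. \<theta> \<in> \<Theta>) \<theta>s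
    \<and> (AE x in law MX pD. AE z in MZ. q \<phi>s x z = posterior MZ prior (p \<theta>s) x z)
    \<and> (AE x in law MX pD. AE z in law MZ prior.
        ereal (Ts x z) =
          elog (joint prior (p \<theta>s) x z / (marginal MZ prior (p \<theta>s) x * prior z)))"
proof -
  interpret sigma_finite_measure MZ by fact
  have \<theta>s: "\<theta>s \<in> \<Theta>" and \<phi>s: "\<phi>s \<in> \<Phi>"
    and opt1: "is_arg_max (payoff1 (law MX pD) (law MZ prior) (\<lambda>x. law MZ (q \<phi>s x)))
       (\<lambda>T. (\<lambda>(x, z). T x z) \<in> borel_measurable (MX \<Otimes>\<^sub>M MZ)) Ts"
    and opt2: "\<And>\<theta> \<phi>. \<theta> \<in> \<Theta> \<Longrightarrow> \<phi> \<in> \<Phi> \<Longrightarrow>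
      payoff2 (law MX pD) N (p \<theta>) (\<zeta> \<phi>) Ts \<le> payoff2 (law MX pD) N (p \<theta>s) (\<zeta> \<phi>s) Ts"
    using nash by (auto simp: nash_equilibrium_def is_arg_max_def not_less)
  have [measurable]: "(\<lambda>(x, z). Ts x z) \<in> borel_measurable (MX \<Otimes>\<^sub>M MZ)"
    using opt1 by (simp add: is_arg_max_def)
  have p_meas[measurable]: "(\<lambda>(x, z). p \<theta> x z) \<in> borel_measurable (MX \<Otimes>\<^sub>M MZ)" if "\<theta> \<in> \<Theta>" for \<theta>
    using measurable_pair_swap[OF cond_density_measurable[OF generative[OF that]]] by simp
  have p_nonneg: "0 \<le> p \<theta> x z" if "\<theta> \<in> \<Theta>" "x \<in> space MX" "z \<in> space MZ" for \<theta> x z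
    using cond_densityD(2)[OF generative[OF that(1)] that(3,2)] .
  have [measurable]: "prior \<in> borel_measurable MZ" and prior_nonneg: "\<And>z. z \<in> space MZ \<Longrightarrow> 0 \<le> prior z"
    using prior by (simp_all add: prob_density_def)
  define D where "D = law MX pD"
  define F where "F \<theta> x z = ereal (- Ts x z) + elog (p \<theta> x z)" for \<theta> x z
  have F[measurable]: "(\<lambda>(x, z). F \<theta> x z) \<in> borel_measurable (MX \<Otimes>\<^sub>M MZ)" if [measurable]: "\<theta> \<in> \<Theta>" for \<theta>
    unfolding F_def by measurable
  let ?J = "\<lambda>\<theta> r. expect D (\<lambda>x. expect (law MZ (r x)) (F \<theta> x))"
  have payoff2: "payoff2 (law MX pD) N (p \<theta>) (\<zeta> \<phi>) Ts = ?J \<theta> (q \<phi>)" if "\<theta> \<in> \<Theta>" "\<phi> \<in> \<Phi>" for \<theta> \<phi>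
    unfolding D_def F_def
    using that F[OF that(1)] by (intro payoff2_eq reparam_measurable reparam) (simp_all add: F_def)
  \<comment> \<open>By \<open>universal\<close> every conditional density can be played up to null
    sets, which leave its laws unchanged. So the equilibrium also beats every pair of a parameter
    and an arbitrary density.\<close>
  have best: "?J \<theta> r \<le> ?J \<theta>s (q \<phi>s)" if \<theta>: "\<theta> \<in> \<Theta>" and r: "cond_density MX MZ r" for \<theta> r
  proof -
    obtain \<phi> where \<phi>: "\<phi> \<in> \<Phi>" and eq: "\<forall>x\<in>space MX. AE z in MZ. q \<phi> x z = r x z"
      using universal[OF r] by blast
    have "?J \<theta> r = ?J \<theta> (q \<phi>)"
    proof (rule expect_cong)
      fix x assume "x \<in> space D"
      then have x: "x \<in> space MX" by (simp add: D_def)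
      have "law MZ (q \<phi> x) = law MZ (r x)"
        using eq x by (intro law_cong_AE cond_densityD(1)[OF inference[OF \<phi>] x] cond_densityD(1)[OF r x]) simp
      then show "expect (law MZ (r x)) (F \<theta> x) = expect (law MZ (q \<phi> x)) (F \<theta> x)" by simp
    qed
    also have "\<dots> \<le> ?J \<theta>s (q \<phi>s)"
      using opt2[OF \<theta> \<phi>] by (simp add: payoff2 \<theta> \<phi> \<theta>s \<phi>s)
    finally show ?thesis .
  qed
  have fin: "\<bar>?J \<theta>s (q \<phi>s)\<bar> \<noteq> \<infinity>"
    using finite_payoff by (simp add: payoff2 \<theta>s \<phi>s)
  have qs: "cond_density MX MZ (q \<phi>s)"
    using inference \<phi>s .
  have disc: "AE x in D. AE z in MZ. (0 < q \<phi>s x z \<longleftrightarrow> 0 < prior z) \<and>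
      (0 < q \<phi>s x z \<longrightarrow> Ts x z = ln (q \<phi>s x z / prior z))"
    unfolding D_def by (rule optimal_discriminator) fact+
  define h where "h x = expect (law MZ (q \<phi>s x)) (F \<theta>s x)" for x
  have const: "AE x in D. \<bar>h x\<bar> \<noteq> \<infinity> \<and> (AE z in law MZ (q \<phi>s x). F \<theta>s x z = h x)"
    unfolding h_def
  \<comment> \<open>The outer space is \<open>D\<close> instead of \<open>MX\<close>; conditional
    densities see only its measurable sets.\<close>
  proof (rule best_response_constant[OF \<open>sigma_finite_measure MZ\<close> _ _ fin])
    have "(\<lambda>(x, z). F \<theta>s x z) \<in> borel_measurable (MX \<Otimes>\<^sub>M MZ)"
      using F \<theta>s .
    then show "(\<lambda>(x, z). F \<theta>s x z) \<in> borel_measurable (D \<Otimes>\<^sub>M MZ)"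
      unfolding D_def by measurable
  qed (use qs best[OF \<theta>s] in \<open>auto simp: D_def\<close>)
  \<comment> \<open>The constant is \<open>c = exp (h x)\<close>. Integrating
    \<open>?j x z = c * q \<phi>s x z\<close> over \<open>z\<close> identifies it as the
    evidence.\<close>
  let ?j = "joint prior (p \<theta>s)" and ?m = "marginal MZ prior (p \<theta>s)"
  have key: "AE x in D. \<exists>c. 0 < c \<and> h x = ereal (ln c) \<and> ?m x = c \<and> (AE z in MZ. ?j x z = c * q \<phi>s x z)"
    using disc const AE_space
  proof eventually_elim
    case (elim x)
    then have x[measurable]: "x \<in> space MX" by (simp add: D_def)
    obtain c0 where c0: "h x = ereal c0"
      using elim by auto
    note q_meas[measurable] = cond_densityD(1)[OF qs x]
    have "AE z in MZ. 0 < q \<phi>s x z \<longrightarrow> F \<theta>s x z = ereal c0"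
      using elim by (simp add: AE_law_iff c0)
    with elim(1) AE_space have joint: "AE z in MZ. ?j x z = exp c0 * q \<phi>s x z"
    proof eventually_elim
      case (elim z)
      show ?case
      proof (cases "0 < q \<phi>s x z")
        case True
        then have prior_pos: "0 < prior z" and T: "Ts x z = ln (q \<phi>s x z / prior z)"
          and "F \<theta>s x z = ereal c0"
          using elim by auto
        \<comment> \<open>A vanishing likelihood would make \<open>F \<theta>s x z\<close> equal to
          \<open>-\<infinity>\<close>, not the real \<open>c0\<close>.\<close>
        then have p_pos: "0 < p \<theta>s x z" and "ln (p \<theta>s x z) - Ts x z = c0"
          by (auto simp: F_def elog_def split: if_splits)
        then have "ln (p \<theta>s x z * prior z / q \<phi>s x z) = c0"
          using True prior_pos by (simp add: T ln_div ln_mult)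
        then have "p \<theta>s x z * prior z / q \<phi>s x z = exp c0"
          using True prior_pos p_pos by (metis divide_pos_pos exp_ln mult_pos_pos)
        then show ?thesis
          using True by (simp add: joint_def field_simps)
      next
        case False
        \<comment> \<open>Optimality of the discriminator makes the prior vanish wherever
          \<open>q\<close> does, so both sides are 0.\<close>
        then have "q \<phi>s x z = 0" "prior z = 0"
          using elim prior_nonneg[of z] cond_densityD(2)[OF qs x, of z] by linarith+
        then show ?thesis
          by (simp add: joint_def)
      qed
    qed
    have "has_bochner_integral MZ (q \<phi>s x) 1"
      using cond_densityD[OF qs x] by (intro has_bochner_integral_nn_integral) (auto intro!: AE_I2)
    then have "integral\<^sup>L MZ (q \<phi>s x) = 1"
      by (rule has_bochner_integral_integral_eq)
    moreover have "?m x = (\<integral>z. exp c0 * q \<phi>s x z \<partial>MZ)"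
      unfolding marginal_def
    proof (rule integral_cong_AE[OF _ _ joint])
      note [measurable] = p_meas[OF \<theta>s]
      show "?j x \<in> borel_measurable MZ"
        unfolding joint_def by measurable
    qed measurable
    ultimately have "?m x = exp c0" by simp
    then show ?case
      using joint c0 by (intro exI[of _ "exp c0"]) simp
  qed
  have post: "AE x in D. AE z in MZ. q \<phi>s x z = posterior MZ prior (p \<theta>s) x z"
    using key
  proof eventually_elim
    case (elim x)
    then obtain c where c: "0 < c" "?m x = c" and "AE z in MZ. ?j x z = c * q \<phi>s x z" by blast
    from this(3) show ?case
      by eventually_elim (use c in \<open>simp add: posterior_def\<close>)
  qed
  \<comment> \<open>The factor \<open>c\<close> cancels and leaves \<open>q / prior\<close>. Where
    the prior and \<open>q\<close> both vanish the discriminator loss is 0 for every value, so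
    nothing can be claimed there.\<close>
  have pmi: "AE x in D. AE z in law MZ prior.
      ereal (Ts x z) = elog (?j x z / (?m x * prior z))"
    using key disc
  proof eventually_elim
    case (elim x)
    then obtain c where c: "0 < c" "?m x = c" and "AE z in MZ. ?j x z = c * q \<phi>s x z" by blast
    from this(3) elim(2) have "AE z in MZ. 0 < prior z \<longrightarrow> ereal (Ts x z) = elog (?j x z / (?m x * prior z))"
      by eventually_elim (use c in \<open>simp add: elog_def\<close>)
    then show ?case
      by (simp add: AE_law_iff)
  qed
  \<comment> \<open>The payoff of deviating to \<open>\<theta>\<close> with its posterior separates
    the two likelihoods.\<close>
  have mle: "expect D (\<lambda>x. elog (marginal MZ prior (p \<theta>) x)) \<le> expect D (\<lambda>x. elog (?m x))" if \<theta>: "\<theta> \<in> \<Theta>" for \<theta>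
  proof -
    let ?M = "marginal MZ prior (p \<theta>)"
    note [measurable] = p_meas[OF \<theta>]
    have [measurable]: "?M \<in> borel_measurable MX"
      unfolding marginal_def joint_def by measurable
    \<comment> \<open>\<open>?M x\<close> is the junk value \<open>0\<close> if the joint density is not integrable in \<open>z\<close>; where \<open>?M x = 0\<close>
      the bound is trivial because \<open>elog 0 = - \<infinity>\<close>, and any density may be played.\<close>
    define r where "r x z = (if 0 < ?M x then p \<theta> x z * prior z / ?M x else prior z)" for x z
    have r_meas[measurable]: "(\<lambda>(x, z). r x z) \<in> borel_measurable (MX \<Otimes>\<^sub>M MZ)"
      unfolding r_def by measurable
    have r: "cond_density MX MZ r"
      unfolding cond_density_def
    proof (intro conjI ballI r_meas)
      fix x assume x[measurable]: "x \<in> space MX"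
      have rx: "r x \<in> borel_measurable MZ" by measurable
      show "prob_density MZ (r x)"
      proof (cases "0 < ?M x")
        case True
        then have "integrable MZ (\<lambda>z. p \<theta> x z * prior z)"
          unfolding marginal_def joint_def using not_integrable_integral_eq by fastforce
        then have "(\<integral>\<^sup>+z. ennreal (p \<theta> x z * prior z / ?M x) \<partial>MZ) =
          ennreal (\<integral>z. p \<theta> x z * prior z / ?M x \<partial>MZ)"
          using True p_nonneg[OF \<theta> x] prior_nonneg
          by (intro nn_integral_eq_integral) (auto intro!: AE_I2)
        also have "(\<integral>z. p \<theta> x z * prior z / ?M x \<partial>MZ) = 1"
          using True by (simp add: marginal_def joint_def)
        finally show ?thesis
          using True p_nonneg[OF \<theta> x] prior_nonneg rx by (simp add: prob_density_def r_def)
      next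
        case False
        then have "r x = prior" by (auto simp: r_def)
        then show ?thesis using prior by simp
      qed
    qed
    have "expect D (\<lambda>x. elog (?M x)) \<le> ?J \<theta> r"
    proof (rule expect_mono_AE)
      show "AE x in D. elog (?M x) \<le> expect (law MZ (r x)) (F \<theta> x)"
        using disc AE_space
      proof eventually_elim
        case (elim x)
        then have x[measurable]: "x \<in> space MX" by (simp add: D_def)
        show ?case
        proof (cases "0 < ?M x")
          case True
          have "ereal (ln (?M x)) \<le> expect (law MZ (\<lambda>z. p \<theta> x z * prior z / ?M x)) (F \<theta> x)"
            unfolding F_def marginal_def joint_def
          proof (rule log_evidence_le_expect_posterior[OF prior _ _ _ _ elim(1)])
            show "prob_density MZ (q \<phi>s x)"
              using qs x by (simp add: cond_density_def)
            show "0 < (\<integral>z. p \<theta> x z * prior z \<partial>MZ)"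
              using True by (simp add: marginal_def joint_def)
          qed (use p_nonneg[OF \<theta> x] in auto)
          then show ?thesis
            using True by (simp add: elog_def r_def[abs_def])
        qed (simp add: elog_def)
      qed
    qed
    also have "\<dots> \<le> ?J \<theta>s (q \<phi>s)"
      by (rule best[OF \<theta> r])
    \<comment> \<open>At equilibrium the conditional payoff \<open>h x\<close> is exactly the log
      evidence, by \<open>key\<close>.\<close>
    also have "\<dots> = expect D (\<lambda>x. elog (?m x))"
      unfolding h_def[symmetric]
      by (rule expect_cong_AE) (use key in \<open>eventually_elim, auto simp: elog_def\<close>)
    finally show ?thesis .
  qed
  show ?thesis
    using post pmi mle \<theta>s unfolding D_def by (auto simp: is_arg_max_def not_less)
qed

end
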